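(* Let $\mathbb K$ be a field and $d\ge0$ an integer. The map which sends a normalized west-south Vandermonde system $(X,\{\theta_i\}_{i=0}^d,\{\theta_i^*\}_{i=0}^d)$ to the matrix $X$ induces a bijection from the set of affine classes of normalized west-south Vandermonde systems in $\mathrm{Mat}_{d+1}(\mathbb K)$ to the set of normalized west-south Vandermonde matrices in $\mathrm{Mat}_{d+1}(\mathbb K)$.
   Context: Rows and columns of matrices in $\mathrm{Mat}_{d+1}(\mathbb K)$ are indexed by $0,\dots,d$. A sequence of polynomials $\{f_i\}_{i=0}^d$ in $\mathbb K[\lambda]$ is graded if $f_0=1$ and $\deg f_i=i$ for $0\le i\le d$. A matrix $X\in\mathrm{Mat}_{d+1}(\mathbb K)$ is west Vandermonde if $X_{i0}\ne0$ for all $i$ and there exist mutually distinct scalars $\{\theta_i\}_{i=0}^d$ in $\mathbb K$ and a graded sequence $\{f_i\}_{i=0}^d$ with $X_{ij}=X_{i0}f_j(\theta_i)$ for $0\le i,j\le d$; then $(X,\{\theta_i\}_{i=0}^d)$ is called a west Vandermonde system. $X$ is south Vandermonde if the matrix obtained by rotating $X$ clockwise by 90 degrees is west Vandermonde; explicitly, $X_{dj}\neq0$ for all $j$ and there exist mutually distinct scalars $\{\theta^*_i\}_{i=0}^d$ in $\mathbb K$ and a graded sequence $\{f^*_i\}_{i=0}^d$ with $X_{ij}=X_{dj}f^*_{d-i}(\theta^*_j)$ for $0\le i,j\le d$; then $(X,\{\theta^*_i\}_{i=0}^d)$ is called a south Vandermonde system. $X$ is west-south Vandermonde if it is both west and south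 Vandermonde; it is normalized if moreover $X_{i0}=1$ and $X_{di}=1$ for $0\le i\le d$. A normalized west-south Vandermonde system is a sequence $(X,\{\theta_i\}_{i=0}^d,\{\theta^*_i\}_{i=0}^d)$ such that $(X,\{\theta_i\})$ is a west Vandermonde system, $(X,\{\theta_i^*\})$ is a south Vandermonde system, and $X$ is normalized. An affine transformation of $(X,\{\theta_i\},\{\theta_i^*\})$ is a system $(X,\{\alpha\theta_i+\beta\},\{\alpha^*\theta_i^*+\beta^*\})$ with $\alpha,\beta,\alpha^*,\beta^*\in\mathbb K$ and $\alpha,\alpha^*$ nonzero (it is again a normalized west-south Vandermonde system). Two normalized west-south Vandermonde systems are affine related if one is an affine transformation of the other; this is an equivalence relation whose classes are called affine classes. *)

theory Defs
  imports "Jordan_Normal_Form.Matrix" "HOL-Computational_Algebra.Polynomial"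
begin

definition graded :: "nat \<Rightarrow> (nat \<Rightarrow> 'a::field poly) \<Rightarrow> bool" where
  "graded d f \<longleftrightarrow> f 0 = 1 \<and> (\<forall>i\<le>d. degree (f i) = i)"

definition west_vandermonde_system :: "nat \<Rightarrow> 'a::field mat \<Rightarrow> 'a vec \<Rightarrow> bool" where
  "west_vandermonde_system d X \<theta> \<longleftrightarrow>
     X \<in> carrier_mat (d + 1) (d + 1) \<and> \<theta> \<in> carrier_vec (d + 1) \<and>
     (\<forall>i\<le>d. X $$ (i, 0) \<noteq> 0) \<and>
     inj_on (\<lambda>i. \<theta> $ i) {0..d} \<and>
     (\<exists>f. graded d f \<and> (\<forall>i\<le>d. \<forall>j\<le>d. X $$ (i, j) = X $$ (i, 0) * poly (f j) (\<theta> $ i)))"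

definition west_vandermonde :: "nat \<Rightarrow> 'a::field mat \<Rightarrow> bool" where
  "west_vandermonde d X \<longleftrightarrow> (\<exists>\<theta>. west_vandermonde_system d X \<theta>)"

definition rotate_clockwise :: "'a mat \<Rightarrow> 'a mat" where
  "rotate_clockwise X = mat (dim_col X) (dim_row X) (\<lambda>(i, j). X $$ (dim_row X - 1 - j, i))"

definition south_vandermonde_system :: "nat \<Rightarrow> 'a::field mat \<Rightarrow> 'a vec \<Rightarrow> bool" where
  "south_vandermonde_system d X \<theta>s \<longleftrightarrow> west_vandermonde_system d (rotate_clockwise X) \<theta>s"

definition south_vandermonde :: "nat \<Rightarrow> 'a::field mat \<Rightarrow> bool" where
  "south_vandermonde d X \<longleftrightarrow> west_vandermonde d (rotate_clockwise X)"

lemma rotate_clockwise_carrier: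
  "rotate_clockwise X \<in> carrier_mat n n \<longleftrightarrow> X \<in> carrier_mat n n"
  unfolding rotate_clockwise_def carrier_mat_def mem_Collect_eq dim_row_mat dim_col_mat by blast

lemma south_vandermonde_system_explicit:
  "south_vandermonde_system d X \<theta>s \<longleftrightarrow>
     X \<in> carrier_mat (d + 1) (d + 1) \<and> \<theta>s \<in> carrier_vec (d + 1) \<and>
     (\<forall>j\<le>d. X $$ (d, j) \<noteq> 0) \<and>
     inj_on (\<lambda>i. \<theta>s $ i) {0..d} \<and>
     (\<exists>f. graded d f \<and>
        (\<forall>i\<le>d. \<forall>j\<le>d. X $$ (i, j) = X $$ (d, j) * poly (f (d - i)) (\<theta>s $ j)))"
proof (cases "X \<in> carrier_mat (d + 1) (d + 1)")
  case True
  have rot: "rotate_clockwise X $$ (i, j) = X $$ (d - j, i)" if "i \<le> d" "j \<le> d" for i j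
    using True that by (simp add: rotate_clockwise_def)
  have "(\<forall>i\<le>d. \<forall>j\<le>d. rotate_clockwise X $$ (i, j) =
            rotate_clockwise X $$ (i, 0) * poly (f j) (\<theta>s $ i)) \<longleftrightarrow>
        (\<forall>i\<le>d. \<forall>j\<le>d. X $$ (i, j) = X $$ (d, j) * poly (f (d - i)) (\<theta>s $ j))"
    (is "?L \<longleftrightarrow> ?R") for f
  proof
    assume L: ?L
    show ?R
    proof (intro allI impI)
      fix i j assume "i \<le> d" "j \<le> d"
      with L[rule_format, of j "d - i"]
      show "X $$ (i, j) = X $$ (d, j) * poly (f (d - i)) (\<theta>s $ j)" by (simp add: rot)
    qed
  next
    assume R: ?R
    show ?L
    proof (intro allI impI)
      fix i j assume "i \<le> d" "j \<le> d"
      with R[rule_format, of "d - j" i]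
      show "rotate_clockwise X $$ (i, j) =
              rotate_clockwise X $$ (i, 0) * poly (f j) (\<theta>s $ i)" by (simp add: rot)
    qed
  qed
  then show ?thesis
    using True
    by (simp add: south_vandermonde_system_def west_vandermonde_system_def
        rotate_clockwise_carrier rot)
next
  case False
  then show ?thesis
    unfolding south_vandermonde_system_def west_vandermonde_system_def rotate_clockwise_carrier
    by blast
qed

definition west_south_vandermonde :: "nat \<Rightarrow> 'a::field mat \<Rightarrow> bool" where
  "west_south_vandermonde d X \<longleftrightarrow> west_vandermonde d X \<and> south_vandermonde d X"

definition normalized :: "nat \<Rightarrow> 'a::field mat \<Rightarrow> bool" where
  "normalized d X \<longleftrightarrow> (\<forall>i\<le>d. X $$ (i, 0) = 1 \<and> X $$ (d, i) = 1)"

definition nws_matrices :: "nat \<Rightarrow> 'a::field mat set" where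
  "nws_matrices d = {X. west_south_vandermonde d X \<and> normalized d X}"

type_synonym 'a nws_system = "'a mat \<times> 'a vec \<times> 'a vec"

definition nws_systems :: "nat \<Rightarrow> 'a::field nws_system set" where
  "nws_systems d = {(X, \<theta>, \<theta>s).
     west_vandermonde_system d X \<theta> \<and> south_vandermonde_system d X \<theta>s \<and> normalized d X}"

definition affine_transformation :: "'a::field nws_system \<Rightarrow> 'a nws_system \<Rightarrow> bool" where
  "affine_transformation = (\<lambda>(X, \<theta>, \<theta>s) T.
     \<exists>\<alpha> \<beta> \<alpha>s \<beta>s. \<alpha> \<noteq> 0 \<and> \<alpha>s \<noteq> 0 \<and>
       T = (X, map_vec (\<lambda>t. \<alpha> * t + \<beta>) \<theta>, map_vec (\<lambda>t. \<alpha>s * t + \<beta>s) \<theta>s))"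

definition affine_related :: "nat \<Rightarrow> ('a::field nws_system \<times> 'a nws_system) set" where
  "affine_related d = {(S, T). S \<in> nws_systems d \<and> T \<in> nws_systems d \<and>
     (affine_transformation S T \<or> affine_transformation T S)}"

definition affine_classes :: "nat \<Rightarrow> 'a::field nws_system set set" where
  "affine_classes d = nws_systems d // affine_related d"

lemma affine_transformationI:
  assumes "a \<noteq> 0" "as \<noteq> 0"
    and "T = (X, map_vec (\<lambda>t. a * t + b) \<theta>, map_vec (\<lambda>t. as * t + bs) \<theta>s)"
  shows "affine_transformation (X, \<theta>, \<theta>s) T"
  unfolding affine_transformation_def prod.case
  by (rule exI[of _ a], rule exI[of _ b], rule exI[of _ as], rule exI[of _ bs]) (intro conjI assms)

lemma affine_transformationE:
  assumes "affine_transformation (X, \<theta>, \<theta>s) T"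
  obtains a b as bs where "a \<noteq> 0" "as \<noteq> 0"
    "T = (X, map_vec (\<lambda>t. a * t + b) \<theta>, map_vec (\<lambda>t. as * t + bs) \<theta>s)"
  using assms unfolding affine_transformation_def prod.case by (elim exE conjE)

lemma affine_transformation_refl: "affine_transformation S S"
proof -
  obtain X \<theta> \<theta>s where S: "S = (X, \<theta>, \<theta>s)" by (cases S)
  show ?thesis unfolding S
    by (rule affine_transformationI[of 1 1 _ _ 0 _ 0]) (simp_all add: vec_eq_iff)
qed

lemma affine_transformation_sym:
  assumes "affine_transformation S T"
  shows "affine_transformation T S"
proof -
  obtain X \<theta> \<theta>s where S: "S = (X, \<theta>, \<theta>s)" by (cases S)
  have inv: "map_vec (\<lambda>t. inverse a * t + (- b / a)) (map_vec (\<lambda>t. a * t + b) v) = v"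
    if "a \<noteq> 0" for a b :: 'a and v
  proof -
    have "inverse a * (a * t + b) + (- b / a) = t" for t
      using that by (simp add: divide_inverse distrib_left mult.assoc[symmetric])
    then show ?thesis by (intro eq_vecI) simp_all
  qed
  from assms show ?thesis unfolding S
  proof (rule affine_transformationE)
    fix a b as bs
    assume a: "a \<noteq> 0" "as \<noteq> 0"
      and T: "T = (X, map_vec (\<lambda>t. a * t + b) \<theta>, map_vec (\<lambda>t. as * t + bs) \<theta>s)"
    show "affine_transformation T (X, \<theta>, \<theta>s)"
      unfolding T
      by (rule affine_transformationI[of "inverse a" "inverse as" _ _ "- b / a" _ "- bs / as"])
        (use a in \<open>simp_all only: inv nonzero_imp_inverse_nonzero not_False_eq_True simp_thms\<close>)
  qed
qed

lemma affine_transformation_trans: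
  assumes "affine_transformation S T" "affine_transformation T U"
  shows "affine_transformation S U"
proof -
  obtain X \<theta> \<theta>s where S: "S = (X, \<theta>, \<theta>s)" by (cases S)
  have comp: "map_vec (\<lambda>t. c * t + e) (map_vec (\<lambda>t. a * t + b) v) =
      map_vec (\<lambda>t. (c * a) * t + (c * b + e)) v" for a b c e :: 'a and v
    by (intro eq_vecI) (simp_all add: algebra_simps)
  from assms(1) show ?thesis unfolding S
  proof (rule affine_transformationE)
    fix a b as bs
    assume a: "a \<noteq> 0" "as \<noteq> 0"
      and T: "T = (X, map_vec (\<lambda>t. a * t + b) \<theta>, map_vec (\<lambda>t. as * t + bs) \<theta>s)"
    from assms(2) show "affine_transformation (X, \<theta>, \<theta>s) U" unfolding T
    proof (rule affine_transformationE)
      fix c e cs es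
      assume c: "c \<noteq> 0" "cs \<noteq> 0"
        and U: "U = (X, map_vec (\<lambda>t. c * t + e) (map_vec (\<lambda>t. a * t + b) \<theta>),
                        map_vec (\<lambda>t. cs * t + es) (map_vec (\<lambda>t. as * t + bs) \<theta>s))"
      have "c * a \<noteq> 0" "cs * as \<noteq> 0" using a c by auto
      then show "affine_transformation (X, \<theta>, \<theta>s) U"
        by (rule affine_transformationI) (simp only: U comp)
    qed
  qed
qed

lemma equiv_affine_related: "equiv (nws_systems d) (affine_related d)"
proof (rule equivI)
  show "affine_related d \<subseteq> nws_systems d \<times> nws_systems d"
    by (auto simp: affine_related_def)
  show "refl_on (nws_systems d) (affine_related d)"
    by (auto simp: refl_on_def affine_related_def affine_transformation_refl)
  show "sym (affine_related d)"
    by (auto simp: sym_def affine_related_def)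
  show "trans (affine_related d)"
    unfolding trans_def affine_related_def
    by (blast intro: affine_transformation_sym affine_transformation_trans)
qed

lemma west_vandermonde_system_affine:
  assumes W: "west_vandermonde_system d X \<theta>" and a: "a \<noteq> 0"
  shows "west_vandermonde_system d X (map_vec (\<lambda>t. a * t + b) \<theta>)"
proof -
  from W obtain f where f: "graded d f"
    "\<forall>i\<le>d. \<forall>j\<le>d. X $$ (i, j) = X $$ (i, 0) * poly (f j) (\<theta> $ i)"
    by (auto simp: west_vandermonde_system_def)
  have dim: "dim_vec \<theta> = d + 1" using W by (simp add: west_vandermonde_system_def)
  define g where "g j = pcompose (f j) [:- b / a, inverse a:]" for j
  have "graded d g" using f(1) a by (simp add: graded_def g_def pcompose_1 degree_pcompose)
  moreover have "poly (g j) (a * t + b) = poly (f j) t" for j t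
  proof -
    have "- b / a + (a * t + b) * inverse a = t" using a by (simp add: field_simps)
    then show ?thesis by (simp add: g_def poly_pcompose)
  qed
  moreover have ix: "map_vec (\<lambda>t. a * t + b) \<theta> $ i = a * \<theta> $ i + b" if "i \<le> d" for i
    using that dim by simp
  ultimately have "\<exists>g. graded d g \<and> (\<forall>i\<le>d. \<forall>j\<le>d. X $$ (i, j) =
      X $$ (i, 0) * poly (g j) (map_vec (\<lambda>t. a * t + b) \<theta> $ i))"
    using f(2) by metis
  moreover have "inj_on (\<lambda>i. map_vec (\<lambda>t. a * t + b) \<theta> $ i) {0..d}"
  proof (rule inj_onI)
    fix i j
    assume ij: "i \<in> {0..d}" "j \<in> {0..d}"
      and "map_vec (\<lambda>t. a * t + b) \<theta> $ i = map_vec (\<lambda>t. a * t + b) \<theta> $ j"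
    then have "\<theta> $ i = \<theta> $ j" using a ix[of i] ix[of j] by simp
    moreover have "inj_on (\<lambda>i. \<theta> $ i) {0..d}"
      using W unfolding west_vandermonde_system_def by blast
    ultimately show "i = j" using ij by (simp add: inj_on_eq_iff)
  qed
  ultimately show ?thesis
    using W unfolding west_vandermonde_system_def map_carrier_vec by blast
qed

lemma affine_transformation_closed:
  assumes "S \<in> nws_systems d" "affine_transformation S T"
  shows "T \<in> nws_systems d"
proof -
  obtain X \<theta> \<theta>s where S: "S = (X, \<theta>, \<theta>s)" by (cases S)
  show ?thesis
    using assms(2) unfolding S
  proof (rule affine_transformationE)
    fix a b as bs
    assume "a \<noteq> 0" "as \<noteq> 0"
      and T: "T = (X, map_vec (\<lambda>t. a * t + b) \<theta>, map_vec (\<lambda>t. as * t + bs) \<theta>s)"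
    with assms(1) show ?thesis
      by (simp add: S T nws_systems_def south_vandermonde_system_def
          west_vandermonde_system_affine)
  qed
qed

(* On a class on which f is constant, the_elem picks out the one element of its image. *)
definition induced_map :: "('a \<Rightarrow> 'b) \<Rightarrow> 'a set \<Rightarrow> 'b" where
  "induced_map f C = the_elem (f ` C)"

end

theory Submission
  imports Defs
begin

text \<open>
  The map from systems to matrices forgets the eigenvalue data, so the content is that \<open>X\<close>
  determines each of \<open>\<theta>\<close> and \<open>\<theta>s\<close> up to an affine substitution. When \<open>d \<ge> 1\<close>, column \<open>1\<close> of a
  west Vandermonde matrix, divided by column \<open>0\<close>, is \<open>f\<^sub>1\<close> evaluated along \<open>\<theta>\<close>, and \<open>f\<^sub>1\<close> has
  degree one; hence \<open>\<theta>\<close> is an invertible affine image of a vector read off from \<open>X\<close> alone, and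
  any two choices of \<open>\<theta>\<close> differ by an invertible affine map
  (\<open>west_vandermonde_system_unique\<close>, which also covers \<open>d = 0\<close>). Rotating \<open>X\<close> gives
  the same for \<open>\<theta>s\<close>. So two systems are affine related exactly when their matrices agree, that is,
  the affine classes are the fibres of the map. A map whose fibres are the classes induces a
  bijection onto its range (\<open>bij_betw_induced_map\<close>), and by definition the matrices that occur
  are the normalized west-south Vandermonde ones.
\<close>

lemma induced_map_class:
  assumes "equiv A r" "f respects r" "x \<in> A"
  shows "induced_map f (r `` {x}) = f x"
proof -
  have "f ` (r `` {x}) = {f x}"
  proof (intro equalityI subsetI)
    fix z assume "z \<in> f ` (r `` {x})"
    then obtain y where "(x, y) \<in> r" "z = f y" by blast
    then show "z \<in> {f x}" using congruentD[OF assms(2), of x y] by simp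
  next
    fix z assume "z \<in> {f x}"
    then show "z \<in> f ` (r `` {x})" using equiv_class_self[OF assms(1,3)] by blast
  qed
  then show ?thesis by (simp add: induced_map_def)
qed

text \<open>
  Compatibility with \<open>r\<close> and the fibre condition together say that \<open>r\<close> is the kernel of \<open>f\<close> on
  \<open>A\<close>, so this is the factorization of a map through the quotient by its kernel.
\<close>

lemma bij_betw_induced_map:
  assumes r: "equiv A r" and f: "f respects r"
    and fibre: "\<And>x y. x \<in> A \<Longrightarrow> y \<in> A \<Longrightarrow> f x = f y \<Longrightarrow> (x, y) \<in> r"
  shows "bij_betw (induced_map f) (A // r) (f ` A)"
proof (rule bij_betw_imageI)
  show "inj_on (induced_map f) (A // r)"
  proof (rule inj_onI, elim quotientE)
    fix C D x y
    assume "induced_map f C = induced_map f D" "x \<in> A" "C = r `` {x}" "y \<in> A" "D = r `` {y}"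
    then show "C = D"
      using fibre[of x y] by (simp add: induced_map_class[OF r f] equiv_class_eq[OF r])
  qed
  show "induced_map f ` (A // r) = f ` A"
  proof -
    have "A // r = (\<lambda>x. r `` {x}) ` A" by (auto simp: quotient_def)
    then have "induced_map f ` (A // r) = (\<lambda>x. induced_map f (r `` {x})) ` A"
      by (simp only: image_image)
    also have "\<dots> = f ` A" by (rule image_cong) (simp_all add: induced_map_class[OF r f])
    finally show ?thesis .
  qed
qed

lemma degree_1_imp_poly_affine:
  fixes p :: "'a::field poly"
  assumes "degree p = 1"
  obtains a b where "a \<noteq> 0" "\<And>t. poly p t = a * t + b"
proof -
  obtain b a where "p = [:b, a:]" "a \<noteq> 0" using degree1_coeffs[OF assms] by metis
  then show ?thesis using that[of a b] by (simp add: algebra_simps)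
qed

text \<open>
  For \<open>d = 0\<close> there is no column \<open>1\<close> to compare, but \<open>\<theta>\<close> then has a single entry and a
  translation suffices.
\<close>

lemma west_vandermonde_system_unique:
  fixes X :: "'a::field mat"
  assumes W: "west_vandermonde_system d X \<theta>" and W': "west_vandermonde_system d X \<theta>'"
  obtains a b where "a \<noteq> 0" "\<theta>' = map_vec (\<lambda>t. a * t + b) \<theta>"
proof -
  have dims: "dim_vec \<theta> = d + 1" "dim_vec \<theta>' = d + 1"
    using W W' by (auto simp: west_vandermonde_system_def)
  have "\<exists>a b. a \<noteq> 0 \<and> (\<forall>i\<le>d. \<theta>' $ i = a * \<theta> $ i + b)"
  proof (cases "d = 0")
    case True
    then show ?thesis by (intro exI[of _ 1] exI[of _ "\<theta>' $ 0 - \<theta> $ 0"]) simp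
  next
    case False
    then have d: "1 \<le> d" by simp
    have column1: "\<exists>a b. a \<noteq> 0 \<and> (\<forall>i\<le>d. X $$ (i, 1) / X $$ (i, 0) = a * \<eta> $ i + b)"
      if V: "west_vandermonde_system d X \<eta>" for \<eta>
    proof -
      obtain f where f: "graded d f"
        "\<forall>i\<le>d. \<forall>j\<le>d. X $$ (i, j) = X $$ (i, 0) * poly (f j) (\<eta> $ i)"
        using V by (auto simp: west_vandermonde_system_def)
      have "degree (f 1) = 1" using f(1) d by (simp add: graded_def)
      then obtain a b where "a \<noteq> 0" and ab: "\<And>t. poly (f 1) t = a * t + b"
        using degree_1_imp_poly_affine by metis
      moreover have "X $$ (i, 1) / X $$ (i, 0) = a * \<eta> $ i + b" if "i \<le> d" for i
      proof -
        have "X $$ (i, 0) \<noteq> 0" using V that by (simp add: west_vandermonde_system_def)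
        moreover have "X $$ (i, 1) = X $$ (i, 0) * (a * \<eta> $ i + b)"
          using f(2) that d ab by metis
        ultimately show ?thesis by simp
      qed
      ultimately show ?thesis by blast
    qed
    obtain a b a' b' where nz: "a \<noteq> 0" "a' \<noteq> 0"
      and ab: "\<forall>i\<le>d. X $$ (i, 1) / X $$ (i, 0) = a * \<theta> $ i + b"
      and ab': "\<forall>i\<le>d. X $$ (i, 1) / X $$ (i, 0) = a' * \<theta>' $ i + b'"
      using column1[OF W] column1[OF W'] by metis
    have "\<theta>' $ i = (a / a') * \<theta> $ i + (b - b') / a'" if "i \<le> d" for i
    proof -
      have "a' * \<theta>' $ i + b' = a * \<theta> $ i + b" using ab ab' that by metis
      then have "\<theta>' $ i = (a * \<theta> $ i + b - b') / a'"
        using nz by (simp add: eq_divide_eq eq_diff_eq mult.commute)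
      then show ?thesis by (simp add: add_divide_distrib diff_divide_distrib)
    qed
    then show ?thesis using nz by (intro exI[of _ "a / a'"] exI[of _ "(b - b') / a'"]) simp
  qed
  then obtain a b where "a \<noteq> 0" and ab: "\<forall>i\<le>d. \<theta>' $ i = a * \<theta> $ i + b" by blast
  moreover have "\<theta>' = map_vec (\<lambda>t. a * t + b) \<theta>"
    using ab dims by (intro eq_vecI) auto
  ultimately show ?thesis using that by blast
qed

lemma nws_systems_same_matrix_imp_affine_transformation:
  assumes "(X, \<theta>, \<theta>s) \<in> nws_systems d" "(X, \<eta>, \<eta>s) \<in> nws_systems d"
  shows "affine_transformation (X, \<theta>, \<theta>s) (X, \<eta>, \<eta>s)"
proof -
  obtain a b where "a \<noteq> 0" "\<eta> = map_vec (\<lambda>t. a * t + b) \<theta>"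
    using assms west_vandermonde_system_unique[of d X \<theta> \<eta>] by (auto simp: nws_systems_def)
  moreover obtain as bs where "as \<noteq> 0" "\<eta>s = map_vec (\<lambda>t. as * t + bs) \<theta>s"
    using assms west_vandermonde_system_unique[of d "rotate_clockwise X" \<theta>s \<eta>s]
    by (auto simp: nws_systems_def south_vandermonde_system_def)
  ultimately show ?thesis by (auto intro: affine_transformationI)
qed

lemma matrices_of_nws_systems: "(\<lambda>(X, \<theta>, \<theta>s). X) ` nws_systems d = nws_matrices d"
proof (intro equalityI subsetI)
  fix X :: "'a::field mat"
  assume "X \<in> (\<lambda>(X, \<theta>, \<theta>s). X) ` nws_systems d"
  then obtain \<theta> \<theta>s where "(X, \<theta>, \<theta>s) \<in> nws_systems d" by auto
  then show "X \<in> nws_matrices d"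
    unfolding nws_systems_def nws_matrices_def west_south_vandermonde_def
      west_vandermonde_def south_vandermonde_def south_vandermonde_system_def
    by blast
next
  fix X :: "'a mat"
  assume "X \<in> nws_matrices d"
  then obtain \<theta> \<theta>s where "(X, \<theta>, \<theta>s) \<in> nws_systems d"
    unfolding nws_systems_def nws_matrices_def west_south_vandermonde_def
      west_vandermonde_def south_vandermonde_def south_vandermonde_system_def
    by blast
  then show "X \<in> (\<lambda>(X, \<theta>, \<theta>s). X) ` nws_systems d"
    by (rule rev_image_eqI) simp
qed

theorem corollary19p10:
  fixes d :: nat
  shows "(\<lambda>(X, \<theta>, \<theta>s). X) respects (affine_related d :: ('a::field nws_system \<times> 'a nws_system) set) \<and>
    bij_betw (induced_map (\<lambda>(X, \<theta>, \<theta>s). X))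
      (affine_classes d :: 'a nws_system set set) (nws_matrices d)"
proof
  show respects: "(\<lambda>(X, \<theta>, \<theta>s). X) respects
      (affine_related d :: ('a nws_system \<times> 'a nws_system) set)"
    by (auto simp: congruent_def affine_related_def affine_transformation_def)
  show "bij_betw (induced_map (\<lambda>(X, \<theta>, \<theta>s). X))
      (affine_classes d :: 'a nws_system set set) (nws_matrices d)"
    unfolding affine_classes_def matrices_of_nws_systems[symmetric]
  proof (rule bij_betw_induced_map[OF equiv_affine_related respects])
    fix S T :: "'a nws_system"
    assume "S \<in> nws_systems d" "T \<in> nws_systems d"
      "(case S of (X, \<theta>, \<theta>s) \<Rightarrow> X) = (case T of (X, \<theta>, \<theta>s) \<Rightarrow> X)"
    then show "(S, T) \<in> affine_related d"
      using nws_systems_same_matrix_imp_affine_transformation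
      by (cases S, cases T) (auto simp: affine_related_def)
  qed
qed

end
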